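(* Let $\mathcal U$ be a non-principal ultrafilter on $\omega$. Then: (a) $\mathrm{add}(\ell^0_{\mathcal U})=\min\{\mathfrak p'(\mathcal U),\mathfrak b\}$; (b) $\mathrm{cov}(\ell^0_{\mathcal U})=\min\{\pi\mathfrak p(\mathcal U),\mathfrak b\}$; (c) $\mathrm{non}(\ell^0_{\mathcal U})=\max\{\pi\chi_\sigma(\mathcal U),\mathfrak d\}$; (d) $\mathrm{cof}(\ell^0_{\mathcal U})=\max\{\chi_\sigma(\mathcal U),\mathfrak d\}$.
   Context: $[\omega]^\omega$ denotes the infinite subsets of $\omega$; $A\subseteq^*B$ means $A\setminus B$ is finite. For a non-principal ultrafilter $\mathcal U$ on $\omega$: $\mathfrak p'(\mathcal U)=\min\{|\mathcal A|:\mathcal A\subseteq\mathcal U$ and for every countable $\bar B\subseteq\mathcal U$ there is $A\in\mathcal A$ with $B\not\subseteq^*A$ for all $B\in\bar B\}$; $\pi\mathfrak p(\mathcal U)=\min\{|\mathcal A|:\mathcal A\subseteq\mathcal U$ and there is no $B\in[\omega]^\omega$ with $B\subseteq^*A$ for all $A\in\mathcal A\}$; $\pi\chi_\sigma(\mathcal U)=\min\{|\mathcal A|:\mathcal A\subseteq[\omega]^\omega$ and for every countable $\bar B\subseteq\mathcal U$ there is $A\in\mathcal A$ with $A\subseteq^*B$ for all $B\in\bar B\}$; $\chi_\sigma(\mathcal U)=\min\{|\mathcal A|:\mathcal A$ is a family of countable subsets of $\mathcal U$ such that for every countable $\bar B\subseteq\mathcal U$ there is $\bar A\in\mathcal A$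 with: for all $B\in\bar B$ some $A\in\bar A$ satisfies $A\subseteq^*B\}$. $\mathfrak b$ is the least size of a family $\mathcal F\subseteq\omega^\omega$ not bounded under eventual domination $\le^*$; $\mathfrak d$ is the least size of a family $\mathcal F\subseteq\omega^\omega$ such that every $g\in\omega^\omega$ satisfies $g\le^* f$ for some $f\in\mathcal F$. $\omega^{\uparrow<\omega}$ ($\omega^{\uparrow\omega}$) denotes the strictly increasing finite (infinite) sequences of naturals. A Laver tree for $\mathcal U$ is a tree $T\subseteq\omega^{\uparrow<\omega}$ (closed under initial segments) with a stem (the maximal node comparable with all nodes of $T$) such that for each $\sigma\in T$ extending the stem, $\{n:\sigma^\frown\langle n\rangle\in T\}\in\mathcal U$; $[T]$ is the set of branches of $T$. The ideal $\ell^0_{\mathcal U}$ consists of all $X\subseteq\omega^{\uparrow\omega}$ such that for every Laver tree $T$ for $\mathcal U$ there is a Laver tree $S\subseteq T$ for $\mathcal U$ with $X\cap[S]=\emptyset$. For an ideal $\mathcal I$ on $\omega^{\uparrow\omega}$: $\mathrm{add}(\mathcal I)$ is the least size of a subfamily of $\mathcal I$ whose union is not in $\mathcal I$; $\mathrm{cov}(\mathcal I)$ the least size of a subfamily covering $\omega^{\uparrow\omega}$; $\mathrm{non}(\mathcal I)$ the least size of a set not in $\mathcal I$; $\mathrm{cof}(\mathcal I)$ the least size of a subfamily $\mathcal F\subseteq\mathcal I$ such that every member of $\mathcal I$ is contained in some member of $\mathcal F$. *)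

theory Defs
  imports "HOL-Library.Countable_Set" "HOL-Library.Sublist"
begin

unbundle cardinal_syntax

text \<open>
  Cardinals are represented, as in the library, by cardinal orders up to order isomorphism
  \<open>=o\<close>. The choice below is only meaningful
  if some set satisfies \<open>P\<close>.
\<close>

definition least_card :: "('a set \<Rightarrow> bool) \<Rightarrow> 'a rel" where
  "least_card P = |SOME A. P A \<and> (\<forall>B. P B \<longrightarrow> |A| \<le>o |B| )|"

lemma least_card_Card_order: "Card_order (least_card P)"
  unfolding least_card_def by (rule card_of_Card_order)

lemma least_card_SOME:
  assumes "P C"
  shows "P (SOME A. P A \<and> (\<forall>B. P B \<longrightarrow> |A| \<le>o |B| )) \<and>
    (\<forall>B. P B \<longrightarrow> |SOME A. P A \<and> (\<forall>B. P B \<longrightarrow> |A| \<le>o |B| )| \<le>o |B| )"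
proof -
  let ?R = "card_of ` Collect P"
  have "\<exists>r\<in>?R. \<forall>r'\<in>?R. r \<le>o r'"
    using assms by (intro exists_minim_Card_order) (auto simp: card_of_Card_order)
  then have "\<exists>A. P A \<and> (\<forall>B. P B \<longrightarrow> |A| \<le>o |B| )"
    by auto
  then show ?thesis
    by (rule someI_ex)
qed

lemma least_card_attained:
  assumes "P C"
  shows "\<exists>A. P A \<and> least_card P = |A|"
  using least_card_SOME[of P, OF assms] unfolding least_card_def by blast

lemma least_card_le:
  assumes "P C"
  shows "least_card P \<le>o |C|"
  using least_card_SOME[of P, OF assms] assms unfolding least_card_def by blast

text \<open>
  The minimum and maximum of two cardinals that may live on different types: the smaller
  (larger) one of the two, copied into the sum type.
\<close>

definition card_min :: "'a rel \<Rightarrow> 'b rel \<Rightarrow> ('a + 'b) rel" where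
  "card_min r s = (if r \<le>o s then dir_image r Inl else dir_image s Inr)"

definition card_max :: "'a rel \<Rightarrow> 'b rel \<Rightarrow> ('a + 'b) rel" where
  "card_max r s = (if r \<le>o s then dir_image s Inr else dir_image r Inl)"

lemma card_min_ordIso:
  assumes "Card_order r" "Card_order s"
  shows "r \<le>o s \<Longrightarrow> card_min r s =o r" "s \<le>o r \<Longrightarrow> card_min r s =o s"
proof -
  have 1: "dir_image r (Inl :: _ \<Rightarrow> 'a + 'b) =o r" "dir_image s (Inr :: _ \<Rightarrow> 'a + 'b) =o s"
    using assms by (auto intro!: ordIso_symmetric[OF dir_image])
  then show "r \<le>o s \<Longrightarrow> card_min r s =o r" by (simp add: card_min_def)
  assume "s \<le>o r"
  then show "card_min r s =o s"
    using 1 by (auto simp: card_min_def ordIso_iff_ordLeq intro: ordLeq_transitive)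
qed

lemma card_max_ordIso:
  assumes "Card_order r" "Card_order s"
  shows "r \<le>o s \<Longrightarrow> card_max r s =o s" "s \<le>o r \<Longrightarrow> card_max r s =o r"
proof -
  have 1: "dir_image r (Inl :: _ \<Rightarrow> 'a + 'b) =o r" "dir_image s (Inr :: _ \<Rightarrow> 'a + 'b) =o s"
    using assms by (auto intro!: ordIso_symmetric[OF dir_image])
  then show "r \<le>o s \<Longrightarrow> card_max r s =o s" by (simp add: card_max_def)
  assume "s \<le>o r"
  then show "card_max r s =o r"
    using 1 by (auto simp: card_max_def ordIso_iff_ordLeq intro: ordLeq_transitive)
qed

definition ultrafilter :: "nat set set \<Rightarrow> bool" where
  "ultrafilter U \<longleftrightarrow>
     UNIV \<in> U \<and> {} \<notin> U \<and>
     (\<forall>A B. A \<in> U \<longrightarrow> A \<subseteq> B \<longrightarrow> B \<in> U) \<and>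
     (\<forall>A B. A \<in> U \<longrightarrow> B \<in> U \<longrightarrow> A \<inter> B \<in> U) \<and>
     (\<forall>A. A \<in> U \<or> - A \<in> U)"

definition nonprincipal :: "nat set set \<Rightarrow> bool" where
  "nonprincipal U \<longleftrightarrow> \<not> (\<exists>n. U = {A. n \<in> A})"

definition almost_subset :: "nat set \<Rightarrow> nat set \<Rightarrow> bool" (infix "\<subseteq>*" 50) where
  "A \<subseteq>* B \<longleftrightarrow> finite (A - B)"

definition p_prime :: "nat set set \<Rightarrow> nat set rel" where
  "p_prime U = least_card (\<lambda>\<A>. \<A> \<subseteq> U \<and>
     (\<forall>\<B>. countable \<B> \<and> \<B> \<subseteq> U \<longrightarrow> (\<exists>A\<in>\<A>. \<forall>B\<in>\<B>. \<not> B \<subseteq>* A)))"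

definition pi_p :: "nat set set \<Rightarrow> nat set rel" where
  "pi_p U = least_card (\<lambda>\<A>. \<A> \<subseteq> U \<and>
     \<not> (\<exists>B. infinite B \<and> (\<forall>A\<in>\<A>. B \<subseteq>* A)))"

definition pi_chi_sigma :: "nat set set \<Rightarrow> nat set rel" where
  "pi_chi_sigma U = least_card (\<lambda>\<A>. \<A> \<subseteq> {A. infinite A} \<and>
     (\<forall>\<B>. countable \<B> \<and> \<B> \<subseteq> U \<longrightarrow> (\<exists>A\<in>\<A>. \<forall>B\<in>\<B>. A \<subseteq>* B)))"

definition chi_sigma :: "nat set set \<Rightarrow> nat set set rel" where
  "chi_sigma U = least_card (\<lambda>\<AA>. \<AA> \<subseteq> {\<A>. countable \<A> \<and> \<A> \<subseteq> U} \<and>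
     (\<forall>\<B>. countable \<B> \<and> \<B> \<subseteq> U \<longrightarrow> (\<exists>\<A>\<in>\<AA>. \<forall>B\<in>\<B>. \<exists>A\<in>\<A>. A \<subseteq>* B)))"

definition eventually_le :: "(nat \<Rightarrow> nat) \<Rightarrow> (nat \<Rightarrow> nat) \<Rightarrow> bool" (infix "\<le>*" 50) where
  "f \<le>* g \<longleftrightarrow> (\<forall>\<^sub>F n in sequentially. f n \<le> g n)"

definition bounding_number :: "(nat \<Rightarrow> nat) rel" where
  "bounding_number = least_card (\<lambda>F. \<not> (\<exists>g. \<forall>f\<in>F. f \<le>* g))"

definition dominating_number :: "(nat \<Rightarrow> nat) rel" where
  "dominating_number = least_card (\<lambda>F. \<forall>g. \<exists>f\<in>F. g \<le>* f)"

definition incr_fin :: "nat list set" where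
  "incr_fin = {s. sorted_wrt (<) s}"

definition incr_inf :: "(nat \<Rightarrow> nat) set" where
  "incr_inf = {x. strict_mono x}"

definition is_tree :: "nat list set \<Rightarrow> bool" where
  "is_tree T \<longleftrightarrow> T \<subseteq> incr_fin \<and> (\<forall>t\<in>T. \<forall>s. prefix s t \<longrightarrow> s \<in> T)"

definition comparable_with_all :: "nat list set \<Rightarrow> nat list \<Rightarrow> bool" where
  "comparable_with_all T s \<longleftrightarrow> (\<forall>t\<in>T. prefix s t \<or> prefix t s)"

definition is_stem :: "nat list set \<Rightarrow> nat list \<Rightarrow> bool" where
  "is_stem T s \<longleftrightarrow> s \<in> T \<and> comparable_with_all T s \<and>
     (\<forall>s'\<in>T. comparable_with_all T s' \<longrightarrow> prefix s s' \<longrightarrow> s' = s)"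

definition laver_tree :: "nat set set \<Rightarrow> nat list set \<Rightarrow> bool" where
  "laver_tree U T \<longleftrightarrow> is_tree T \<and>
     (\<exists>s. is_stem T s \<and> (\<forall>t\<in>T. prefix s t \<longrightarrow> {n. t @ [n] \<in> T} \<in> U))"

definition branches :: "nat list set \<Rightarrow> (nat \<Rightarrow> nat) set" where
  "branches T = {x \<in> incr_inf. \<forall>n. map x [0..<n] \<in> T}"

definition laver_ideal :: "nat set set \<Rightarrow> (nat \<Rightarrow> nat) set set" where
  "laver_ideal U = {X. X \<subseteq> incr_inf \<and>
     (\<forall>T. laver_tree U T \<longrightarrow> (\<exists>S. laver_tree U S \<and> S \<subseteq> T \<and> X \<inter> branches S = {}))}"

definition add_ideal :: "'a set set \<Rightarrow> 'a set rel" where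
  "add_ideal I = least_card (\<lambda>F. F \<subseteq> I \<and> \<Union>F \<notin> I)"

definition cov_ideal :: "'a set \<Rightarrow> 'a set set \<Rightarrow> 'a set rel" where
  "cov_ideal \<Omega> I = least_card (\<lambda>F. F \<subseteq> I \<and> \<Omega> \<subseteq> \<Union>F)"

definition non_ideal :: "'a set \<Rightarrow> 'a set set \<Rightarrow> 'a rel" where
  "non_ideal \<Omega> I = least_card (\<lambda>X. X \<subseteq> \<Omega> \<and> X \<notin> I)"

definition cof_ideal :: "'a set set \<Rightarrow> 'a set rel" where
  "cof_ideal I = least_card (\<lambda>F. F \<subseteq> I \<and> (\<forall>X\<in>I. \<exists>Y\<in>F. X \<subseteq> Y))"

end

theory Submission
  imports Defs
begin

text \<open>
  The ideal is generated by the complements of the sets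
  \<open>followers \<phi>\<close> of those \<open>x\<close> with \<open>x n \<in> \<phi> (x \<restriction> n)\<close> for almost all \<open>n\<close>, where \<open>\<phi>\<close> assigns
  a member of \<open>U\<close> to every finite sequence. If \<open>\<psi> s \<subseteq> \<phi> s\<close> for all but finitely many of the
  countably many \<open>s\<close>, then \<open>followers \<psi> \<subseteq> followers \<phi>\<close>; so each invariant of the ideal splits
  into a combinatorial question about \<open>U\<close> at every single \<open>s\<close> and a domination
  question, where the function to be dominated says how much of a set has to be cut off at \<open>s\<close>.
\<close>

section \<open>Comparing least cardinals\<close>

lemma least_card_ordLeq:
  assumes "Q C" and "\<And>A. Q A \<Longrightarrow> \<exists>B. P B \<and> |B| \<le>o |A|"
  shows "least_card P \<le>o least_card Q"
proof -
  obtain A where "Q A" "least_card Q = |A|"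
    using least_card_attained[of Q, OF assms(1)] by blast
  moreover obtain B where "P B" "|B| \<le>o |A|"
    using assms(2)[OF \<open>Q A\<close>] by blast
  ultimately show ?thesis
    using least_card_le[of P, OF \<open>P B\<close>] ordLeq_transitive by force
qed

text \<open>\<open>PQ\<close> and \<open>PR\<close> give the upper bounds. For the lower bound one
  of the two alternatives in \<open>QR\<close> suffices, since it is applied to a single
  \<open>C\<close> of least size. \<open>A0\<close> and \<open>B0\<close> ensure that the least
  cardinals are taken over nonempty classes.\<close>

lemma least_card_eq_card_min:
  assumes "Q A0" "R B0"
    and PQ: "\<And>A. Q A \<Longrightarrow> \<exists>C. P C \<and> |C| \<le>o |A|"
    and PR: "\<And>B. R B \<Longrightarrow> \<exists>C. P C \<and> |C| \<le>o |B|"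
    and QR: "\<And>C. P C \<Longrightarrow> (\<exists>A. Q A \<and> |A| \<le>o |C| ) \<or> (\<exists>B. R B \<and> |B| \<le>o |C| )"
  shows "least_card P =o card_min (least_card Q) (least_card R)"
proof -
  let ?p = "least_card P" and ?q = "least_card Q" and ?r = "least_card R"
  note co = least_card_Card_order[of Q] least_card_Card_order[of R]
  have "?p \<le>o ?q" "?p \<le>o ?r"
    using least_card_ordLeq[of Q] least_card_ordLeq[of R] assms by blast+
  moreover have "?q \<le>o ?p \<or> ?r \<le>o ?p"
  proof -
    obtain C where C: "P C" "?p = |C|"
      using least_card_attained[of P] PQ[OF \<open>Q A0\<close>] by blast
    from QR[OF \<open>P C\<close>] show ?thesis
    proof (elim disjE exE conjE)
      fix A assume "Q A" "|A| \<le>o |C|"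
      then show ?thesis using least_card_le[of Q] C(2) ordLeq_transitive by metis
    next
      fix B assume "R B" "|B| \<le>o |C|"
      then show ?thesis using least_card_le[of R] C(2) ordLeq_transitive by metis
    qed
  qed
  moreover have "?q \<le>o ?r \<or> ?r \<le>o ?q"
    using ordLeq_total[OF co[THEN card_order_on_well_order_on]] by blast
  ultimately consider "?q \<le>o ?r" "?p =o ?q" | "?r \<le>o ?q" "?p =o ?r"
    unfolding ordIso_iff_ordLeq by (metis ordLeq_transitive)
  then show ?thesis
  proof cases
    case 1
    show ?thesis
      by (rule ordIso_transitive[OF 1(2) ordIso_symmetric[OF card_min_ordIso(1)[OF co 1(1)]]])
  next
    case 2
    show ?thesis
      by (rule ordIso_transitive[OF 2(2) ordIso_symmetric[OF card_min_ordIso(2)[OF co 2(1)]]])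
  qed
qed

text \<open>The upper bound comes from a product, and the product of a nonempty set with an infinite
  one has the size of the larger factor; hence \<open>ne\<close> and \<open>inf\<close>.\<close>

lemma least_card_eq_card_max:
  assumes "Q A0" "R B0"
    and QP: "\<And>C. P C \<Longrightarrow> \<exists>A. Q A \<and> |A| \<le>o |C|"
    and RP: "\<And>C. P C \<Longrightarrow> \<exists>B. R B \<and> |B| \<le>o |C|"
    and P: "\<And>A B. Q A \<Longrightarrow> R B \<Longrightarrow> \<exists>C. P C \<and> |C| \<le>o |A \<times> B|"
    and ne: "\<And>A. Q A \<Longrightarrow> A \<noteq> {}"
    and inf: "\<And>B. R B \<Longrightarrow> infinite B"
  shows "least_card P =o card_max (least_card Q) (least_card R)"
proof -
  let ?p = "least_card P" and ?q = "least_card Q" and ?r = "least_card R"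
  note co = least_card_Card_order[of Q] least_card_Card_order[of R]
  obtain A where A: "Q A" "?q = |A|" using least_card_attained[of Q, OF \<open>Q A0\<close>] by blast
  obtain B where B: "R B" "?r = |B|" using least_card_attained[of R, OF \<open>R B0\<close>] by blast
  obtain C where C: "P C" "|C| \<le>o |A \<times> B|" using P[OF A(1) B(1)] by blast
  have qp: "?q \<le>o ?p" and rp: "?r \<le>o ?p"
    using least_card_ordLeq[of P] C QP RP by blast+
  have pAB: "?p \<le>o |A \<times> B|"
    by (rule ordLeq_transitive[OF least_card_le[of P, OF C(1)] C(2)])
  consider "?q \<le>o ?r" | "?r \<le>o ?q"
    using ordLeq_total[OF co[THEN card_order_on_well_order_on]] by blast
  then show ?thesis
  proof cases
    case 1
    then have "|A \<times> B| =o |B|"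
      using card_of_Times_infinite[of B A] ne A B inf by simp
    then have "?p \<le>o ?r" using ordLeq_ordIso_trans[OF pAB] B(2) by simp
    then have "?p =o ?r" using rp by (simp add: ordIso_iff_ordLeq)
    then show ?thesis
      by (rule ordIso_transitive[OF _ ordIso_symmetric[OF card_max_ordIso(1)[OF co 1]]])
  next
    case 2
    then have "infinite A"
      using inf[OF B(1)] A B card_of_ordLeq_infinite by metis
    then have "|A \<times> B| =o |A|"
      using card_of_Times_infinite[of A B] inf[OF B(1)] A B 2 by auto
    then have "?p \<le>o ?q" using ordLeq_ordIso_trans[OF pAB] A(2) by simp
    then have "?p =o ?q" using qp by (simp add: ordIso_iff_ordLeq)
    then show ?thesis
      by (rule ordIso_transitive[OF _ ordIso_symmetric[OF card_max_ordIso(2)[OF co 2]]])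
  qed
qed

section \<open>Domination on finite sequences\<close>

text \<open>Sending \<open>s\<close> to a threshold for \<open>P c s\<close> turns each
  \<open>c\<close> into a function, read on the naturals through the coding of \<open>'a\<close>.
  Either these functions form an unbounded family, or a common bound yields \<open>g\<close>. The
  lower bounds in terms of the bounding number rest on this dichotomy.\<close>

lemma unbounded_or_uniform_threshold:
  fixes P :: "'c \<Rightarrow> 'a :: countable \<Rightarrow> nat \<Rightarrow> bool"
  assumes "\<And>c s. c \<in> C \<Longrightarrow> \<forall>\<^sub>F m in sequentially. P c s m"
  shows "(\<exists>F. \<not> (\<exists>g. \<forall>f\<in>F. f \<le>* g) \<and> |F| \<le>o |C| ) \<or> (\<exists>g. \<forall>c\<in>C. finite {s. \<not> P c s (g s)})"
proof -
  have "\<exists>k. \<forall>m\<ge>k. P c s m" if "c \<in> C" for c s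
    using assms[OF that] by (simp add: eventually_sequentially)
  then obtain k where k: "\<And>c s m. c \<in> C \<Longrightarrow> m \<ge> k c s \<Longrightarrow> P c s m" by metis
  let ?F = "(\<lambda>c n. k c (from_nat n)) ` C"
  show ?thesis
  proof (cases "\<exists>g. \<forall>f\<in>?F. f \<le>* g")
    case True
    then obtain g where g: "\<And>c. c \<in> C \<Longrightarrow> \<forall>\<^sub>F n in sequentially. k c (from_nat n) \<le> g n"
      by (auto simp: eventually_le_def)
    have "finite {s. \<not> P c s (g (to_nat s))}" if "c \<in> C" for c
    proof -
      have "\<forall>\<^sub>F n in sequentially. k c (from_nat n) \<le> g n" using g that .
      then have "finite {n. \<not> k c (from_nat n) \<le> g n}"
        unfolding cofinite_eq_sequentially[symmetric] eventually_cofinite .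
      moreover have "to_nat ` {s. \<not> P c s (g (to_nat s))} \<subseteq> {n. \<not> k c (from_nat n) \<le> g n}"
        using k[OF that] by auto
      ultimately have "finite (to_nat ` {s. \<not> P c s (g (to_nat s))})"
        using finite_subset by blast
      then show ?thesis by (rule finite_imageD) simp
    qed
    then show ?thesis by (intro disjI2 exI[of _ "\<lambda>s. g (to_nat s)"]) blast
  next
    case False
    then show ?thesis using card_of_image by blast
  qed
qed

text \<open>Counterpart for the dominating number: a single threshold function, coded in the same
  way, is dominated by a member of \<open>D\<close>.\<close>

lemma dominating_threshold:
  fixes P :: "'a :: countable \<Rightarrow> nat \<Rightarrow> bool"
  assumes "\<forall>g. \<exists>f\<in>D. g \<le>* f" and "\<And>s. \<forall>\<^sub>F m in sequentially. P s m"
  shows "\<exists>d\<in>D. finite {s. \<not> P s (d (to_nat s))}"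
proof -
  have "\<exists>k. \<forall>m\<ge>k. P s m" for s
    using assms(2) by (simp add: eventually_sequentially)
  then obtain k where k: "\<And>s m. m \<ge> k s \<Longrightarrow> P s m" by metis
  obtain d where "d \<in> D" and d: "(\<lambda>n. k (from_nat n)) \<le>* d" using assms(1) by blast
  have "finite {n. \<not> k (from_nat n) \<le> d n}"
    using d unfolding eventually_le_def cofinite_eq_sequentially[symmetric] eventually_cofinite .
  moreover have "to_nat ` {s. \<not> P s (d (to_nat s))} \<subseteq> {n. \<not> k (from_nat n) \<le> d n}"
    using k by auto
  ultimately have "finite (to_nat ` {s. \<not> P s (d (to_nat s))})"
    using finite_subset by blast
  then have "finite {s. \<not> P s (d (to_nat s))}" by (rule finite_imageD) simp
  with \<open>d \<in> D\<close> show ?thesis by blast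
qed

text \<open>One plus the sum of a finite family lies above every member at every point.\<close>

lemma infinite_of_dominating:
  assumes "\<forall>g. \<exists>f\<in>D. g \<le>* f"
  shows "infinite D"
proof
  assume fin: "finite D"
  define g where "g n = Suc (\<Sum>f\<in>D. f n)" for n
  obtain f where f: "f \<in> D" "g \<le>* f" using assms by blast
  then obtain n where "g n \<le> f n"
    by (auto simp: eventually_le_def eventually_sequentially)
  moreover have "f n \<le> (\<Sum>f\<in>D. f n)" using fin f(1) by (intro member_le_sum) auto
  ultimately show False by (simp add: g_def)
qed

section \<open>Sequences following an assignment\<close>

text \<open>Recursion along initial segments: an infinite \<open>A s\<close> has an element above
  all entries of \<open>s\<close>, which is appended to \<open>s\<close>.\<close>

lemma exists_strict_mono_path:
  assumes "\<And>s. infinite (A s)"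
  shows "\<exists>x::nat \<Rightarrow> nat. strict_mono x \<and> (\<forall>n. x n \<in> A (map x [0..<n]))"
proof -
  have "\<exists>k\<in>A s. \<forall>j\<in>set s. j < k" for s :: "nat list"
  proof -
    \<comment> \<open>\<open>insert 0\<close> covers the empty sequence, which has no largest
      entry.\<close>
    obtain k where "k \<in> A s" "k > Max (insert 0 (set s))"
      using assms[of s] unfolding infinite_nat_iff_unbounded by blast
    then show ?thesis by (intro bexI[of _ k]) (auto simp: Max_less_iff)
  qed
  then obtain h where h: "\<And>s. h s \<in> A s" "\<And>s j. j \<in> set s \<Longrightarrow> j < h s" by metis
  define L where "L = rec_nat [] (\<lambda>_ l. l @ [h l])"
  define x where "x n = h (L n)" for n
  have L: "L n = map x [0..<n]" for n
    by (induction n) (simp_all add: L_def x_def)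
  have "x n < x (Suc n)" for n
    unfolding x_def[of "Suc n"] by (rule h(2)) (simp add: L)
  then have "strict_mono x" by (simp add: strict_mono_Suc_iff)
  moreover have "x n \<in> A (map x [0..<n])" for n
    using h(1)[of "L n"] by (simp add: L[symmetric] x_def)
  ultimately show ?thesis by blast
qed

definition followers :: "(nat list \<Rightarrow> nat set) \<Rightarrow> (nat \<Rightarrow> nat) set" where
  "followers \<phi> = {x \<in> incr_inf. \<forall>\<^sub>F n in sequentially. x n \<in> \<phi> (map x [0..<n])}"

lemma followers_subset_incr_inf: "followers \<phi> \<subseteq> incr_inf"
  by (auto simp: followers_def)

lemma exists_follower:
  assumes "\<And>s. infinite (A s)"
  shows "\<exists>x\<in>followers A. \<forall>n. x n \<in> A (map x [0..<n])"
proof -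
  obtain x where "strict_mono x" "\<forall>n. x n \<in> A (map x [0..<n])"
    using exists_strict_mono_path[of A, OF assms] by blast
  then show ?thesis by (intro bexI[of _ x]) (auto simp: followers_def incr_inf_def)
qed

text \<open>The initial segments of \<open>x\<close> are pairwise distinct, so finitely many
  exceptional \<open>s\<close> affect only finitely many \<open>n\<close>.\<close>

lemma followers_mono:
  assumes "finite {s. \<not> \<psi> s \<subseteq> \<phi> s}"
  shows "followers \<psi> \<subseteq> followers \<phi>"
proof
  fix x assume "x \<in> followers \<psi>"
  then have x: "x \<in> incr_inf" "\<forall>\<^sub>F n in sequentially. x n \<in> \<psi> (map x [0..<n])"
    by (auto simp: followers_def)
  have "inj (\<lambda>n. map x [0..<n])"
    by (rule injI) (metis diff_zero length_map length_upt)
  then have "finite {n. \<not> \<psi> (map x [0..<n]) \<subseteq> \<phi> (map x [0..<n])}"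
    using finite_vimageI[OF assms] by (simp add: vimage_def)
  then have "\<forall>\<^sub>F n in sequentially. \<psi> (map x [0..<n]) \<subseteq> \<phi> (map x [0..<n])"
    by (simp add: cofinite_eq_sequentially[symmetric] eventually_cofinite)
  with x(2) have "\<forall>\<^sub>F n in sequentially. x n \<in> \<phi> (map x [0..<n])"
    by eventually_elim auto
  with x(1) show "x \<in> followers \<phi>" by (simp add: followers_def)
qed

lemma range_almost_subset:
  assumes "\<forall>\<^sub>F n in sequentially. x n \<in> A"
  shows "range x \<subseteq>* A"
proof -
  have "finite {n. x n \<notin> A}"
    using assms unfolding cofinite_eq_sequentially[symmetric] eventually_cofinite .
  moreover have "range x - A \<subseteq> x ` {n. x n \<notin> A}" by auto
  ultimately show ?thesis
    unfolding almost_subset_def using finite_surj by blast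
qed

lemma infinite_range_incr_inf: "x \<in> incr_inf \<Longrightarrow> infinite (range x)"
  by (auto simp: incr_inf_def dest: finite_imageD intro: strict_mono_imp_inj_on)

text \<open>Constant assignments express almost inclusion: a strictly increasing \<open>x\<close> is
  injective, so finitely many exceptional values come from finitely many positions.\<close>

lemma followers_const_iff:
  "x \<in> followers (\<lambda>_. A) \<longleftrightarrow> x \<in> incr_inf \<and> range x \<subseteq>* A"
proof
  assume "x \<in> followers (\<lambda>_. A)"
  then show "x \<in> incr_inf \<and> range x \<subseteq>* A"
    using range_almost_subset by (simp add: followers_def)
next
  assume x: "x \<in> incr_inf \<and> range x \<subseteq>* A"
  then have "finite {n. x n \<in> range x - A}"
    using finite_vimageI[of "range x - A" x] strict_mono_imp_inj_on[of x UNIV]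
    by (simp add: incr_inf_def almost_subset_def vimage_def)
  then have "\<forall>\<^sub>F n in sequentially. x n \<in> A"
    by (simp add: cofinite_eq_sequentially[symmetric] eventually_cofinite)
  with x show "x \<in> followers (\<lambda>_. A)" by (simp add: followers_def)
qed

text \<open>Tails belong to every nonprincipal ultrafilter, so this brings eventual domination into
  the study of the ideal.\<close>

lemma followers_length_iff:
  "x \<in> followers (\<lambda>s. {f (length s)..}) \<longleftrightarrow> x \<in> incr_inf \<and> f \<le>* x"
  by (simp add: followers_def eventually_le_def)

text \<open>The amount \<open>m\<close> to be cut off is the quantity compared in the domination
  arguments.\<close>

lemma almost_subset_cut_eventually:
  assumes "B \<subseteq>* A"
  shows "\<forall>\<^sub>F m in sequentially. B \<inter> {m..} \<subseteq> A"
proof -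
  obtain k where "\<forall>j\<in>B - A. j < k"
    using assms finite_nat_set_iff_bounded unfolding almost_subset_def by blast
  then have "B \<inter> {m..} \<subseteq> A" if "m \<ge> k" for m
    using that by (meson DiffI IntE atLeast_iff le_trans linorder_not_le subsetI)
  then show ?thesis unfolding eventually_sequentially by blast
qed

lemma infinite_cut: "infinite (B :: nat set) \<Longrightarrow> infinite (B \<inter> {m..})"
proof -
  assume "infinite B"
  then have "infinite (B - {..<m})" by simp
  moreover have "B - {..<m} = B \<inter> {m..}" by auto
  ultimately show ?thesis by simp
qed

section \<open>The Laver ideal\<close>

text \<open>The initial segments of \<open>s\<close> are included so that intersecting with a tree
  gives a tree again; that tree also supplies increasingness.\<close>

definition guided_nodes :: "nat list \<Rightarrow> (nat list \<Rightarrow> nat set) \<Rightarrow> nat list set" where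
  "guided_nodes s \<phi> = {t. prefix t s \<or>
     prefix s t \<and> (\<forall>i. length s \<le> i \<and> i < length t \<longrightarrow> t ! i \<in> \<phi> (take i t))}"

text \<open>Unlike in \<open>followers\<close>, the assignment is obeyed without exception from
  \<open>s\<close> on; every follower is guided above one of its own initial segments.\<close>

definition guided_branches :: "nat list \<Rightarrow> (nat list \<Rightarrow> nat set) \<Rightarrow> (nat \<Rightarrow> nat) set" where
  "guided_branches s \<phi> = {x \<in> incr_inf. map x [0..<length s] = s \<and>
     (\<forall>i\<ge>length s. x i \<in> \<phi> (map x [0..<i]))}"

lemma guided_nodes_prefix_closed:
  assumes "t \<in> guided_nodes s \<phi>" "prefix t' t"
  shows "t' \<in> guided_nodes s \<phi>"
proof (cases "prefix t' s")
  case True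
  then show ?thesis by (simp add: guided_nodes_def)
next
  case False
  then have "\<not> prefix t s" using assms(2) prefix_order.trans by blast
  then have t: "prefix s t" "\<And>i. length s \<le> i \<Longrightarrow> i < length t \<Longrightarrow> t ! i \<in> \<phi> (take i t)"
    using assms(1) by (auto simp: guided_nodes_def)
  have "prefix s t'" using t(1) assms(2) False prefix_same_cases by blast
  moreover have "t' ! i \<in> \<phi> (take i t')" if "length s \<le> i" "i < length t'" for i
    using t(2)[of i] that assms(2) by (auto simp: prefix_def nth_append)
  ultimately show ?thesis by (simp add: guided_nodes_def)
qed

lemma guided_nodes_snoc:
  assumes "t \<in> guided_nodes s \<phi>" "prefix s t"
  shows "t @ [n] \<in> guided_nodes s \<phi> \<longleftrightarrow> n \<in> \<phi> t"
proof -
  have t: "t ! i \<in> \<phi> (take i t)" if "length s \<le> i" "i < length t" for i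
  proof (cases "prefix t s")
    case True
    then have "t = s" using assms(2) prefix_order.antisym by blast
    then show ?thesis using that by simp
  next
    case False
    then show ?thesis using assms(1) that by (auto simp: guided_nodes_def)
  qed
  have "\<not> prefix (t @ [n]) s"
    using prefix_length_le[OF assms(2)] prefix_length_le[of "t @ [n]" s] by auto
  then have "t @ [n] \<in> guided_nodes s \<phi> \<longleftrightarrow>
      (\<forall>i. length s \<le> i \<and> i < Suc (length t) \<longrightarrow> (t @ [n]) ! i \<in> \<phi> (take i (t @ [n])))"
    using assms(2) by (auto simp: guided_nodes_def)
  also have "\<dots> \<longleftrightarrow> n \<in> \<phi> t"
    using t prefix_length_le[OF assms(2)]
    by (auto simp: less_Suc_eq nth_append)
  finally show ?thesis .
qed

lemma branches_guided_subset_followers: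
  assumes "S \<subseteq> guided_nodes s \<phi>"
  shows "branches S \<subseteq> followers \<phi>"
proof
  fix x assume "x \<in> branches S"
  then have x: "x \<in> incr_inf" "\<And>n. map x [0..<n] \<in> guided_nodes s \<phi>"
    using assms by (auto simp: branches_def)
  have "x n \<in> \<phi> (map x [0..<n])" if "n \<ge> length s" for n
  proof -
    let ?t = "map x [0..<Suc n]"
    \<comment> \<open>A node longer than \<open>s\<close> falls under the second alternative of
      \<open>guided_nodes\<close>.\<close>
    have "\<not> prefix ?t s"
      using prefix_length_le[of ?t s] that by auto
    then have "?t ! n \<in> \<phi> (take n ?t)"
      using x(2)[of "Suc n"] that by (auto simp: guided_nodes_def simp del: upt_Suc)
    then show ?thesis by (simp add: take_map nth_append)
  qed
  then show "x \<in> followers \<phi>"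
    using x(1) by (auto simp: followers_def eventually_sequentially)
qed

section \<open>Basic properties of nonprincipal ultrafilters\<close>

locale nonprincipal_ultrafilter =
  fixes U :: "nat set set"
  assumes ultrafilter: "ultrafilter U" and nonprincipal: "nonprincipal U"
begin

lemma UNIV_mem: "UNIV \<in> U"
  and empty_not_mem: "{} \<notin> U"
  and mem_mono: "A \<in> U \<Longrightarrow> A \<subseteq> B \<Longrightarrow> B \<in> U"
  and Int_mem: "A \<in> U \<Longrightarrow> B \<in> U \<Longrightarrow> A \<inter> B \<in> U"
  and mem_or_compl_mem: "A \<in> U \<or> - A \<in> U"
  using ultrafilter unfolding ultrafilter_def by blast+

text \<open>Nonprincipality enters here: a singleton \<open>{a}\<close> in \<open>U\<close> would
  make \<open>U\<close> the principal ultrafilter at \<open>a\<close>.\<close>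

lemma compl_finite_mem: "finite A \<Longrightarrow> - A \<in> U"
proof (induction A rule: finite_induct)
  case empty
  then show ?case by (simp add: UNIV_mem)
next
  case (insert a A)
  have "{a} \<notin> U"
  proof
    assume a: "{a} \<in> U"
    have "U = {A. a \<in> A}"
    proof (intro equalityI subsetI CollectI)
      fix A assume "A \<in> U"
      then have "{a} \<inter> A \<noteq> {}" using Int_mem[OF a] empty_not_mem by metis
      then show "a \<in> A" by blast
    next
      fix A assume "A \<in> {A. a \<in> A}"
      then show "A \<in> U" using mem_mono[OF a] by blast
    qed
    then show False using nonprincipal unfolding nonprincipal_def by blast
  qed
  then have "- {a} \<inter> - A \<in> U"
    using insert.IH mem_or_compl_mem Int_mem by blast
  moreover have "- {a} \<inter> - A = - insert a A" by auto
  ultimately show ?case by simp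
qed

lemma mem_infinite: "A \<in> U \<Longrightarrow> infinite A"
  using compl_finite_mem[of A] Int_mem[of A "- A"] empty_not_mem by auto

lemma not_mem_compl: "A \<notin> U \<Longrightarrow> - A \<in> U"
  using mem_or_compl_mem by blast

lemma INT_atMost_mem:
  assumes "\<And>k. k \<le> n \<Longrightarrow> A k \<in> U"
  shows "(\<Inter>k\<le>(n::nat). A k) \<in> U"
  using assms
proof (induction n)
  case 0
  then show ?case by simp
next
  case (Suc n)
  then have "A (Suc n) \<inter> (\<Inter>k\<le>n. A k) \<in> U" by (intro Int_mem) auto
  moreover have "A (Suc n) \<inter> (\<Inter>k\<le>n. A k) = (\<Inter>k\<le>Suc n. A k)"
    by (auto simp: atMost_Suc)
  ultimately show ?case by simp
qed

lemma atLeast_mem: "{m..} \<in> U"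
proof -
  have "- {..<m} \<in> U" by (rule compl_finite_mem) simp
  moreover have "- {..<m} = {m..}" by auto
  ultimately show ?thesis by simp
qed

section \<open>Laver trees and assignments\<close>

text \<open>Successor sets are only intersected with members of \<open>U\<close>, so they stay in
  \<open>U\<close>. The stem survives because its successor set is still infinite, so the tree
  splits there.\<close>

lemma laver_tree_restrict:
  assumes T: "is_tree T" "s \<in> T" "\<And>t. t \<in> T \<Longrightarrow> prefix s t \<Longrightarrow> {n. t @ [n] \<in> T} \<in> U"
    and \<phi>: "\<And>t. \<phi> t \<in> U"
  shows "laver_tree U (T \<inter> guided_nodes s \<phi>)"
proof -
  let ?S = "T \<inter> guided_nodes s \<phi>"
  have tree: "is_tree ?S"
    using T(1) guided_nodes_prefix_closed unfolding is_tree_def by blast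
  have succ: "{n. t @ [n] \<in> ?S} \<in> U" if "t \<in> ?S" "prefix s t" for t
  proof -
    have "{n. t @ [n] \<in> T} \<inter> \<phi> t \<in> U" using T(3) that \<phi> Int_mem by blast
    moreover have "{n. t @ [n] \<in> ?S} = {n. t @ [n] \<in> T} \<inter> \<phi> t"
      using guided_nodes_snoc that by auto
    ultimately show ?thesis by simp
  qed
  have "is_stem ?S s"
    unfolding is_stem_def
  proof (intro conjI ballI impI)
    show s: "s \<in> ?S" using T(2) by (simp add: guided_nodes_def)
    show "comparable_with_all ?S s"
      by (auto simp: comparable_with_all_def guided_nodes_def)
    fix s' assume s': "s' \<in> ?S" "comparable_with_all ?S s'" "prefix s s'"
    show "s' = s"
    proof (rule ccontr)
      assume "s' \<noteq> s"
      then obtain m r where r: "s' = s @ m # r"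
        using s'(3) by (metis append.right_neutral neq_Nil_conv prefix_def)
      \<comment> \<open>A longer candidate for the stem continues \<open>s\<close> with
        \<open>m\<close>, so it is incomparable with \<open>s @ [n]\<close> whenever
        \<open>n\<close> differs from \<open>m\<close>.\<close>
      have "infinite ({n. s @ [n] \<in> ?S} - {m})"
        using mem_infinite[OF succ[OF s]] by simp
      then obtain n where n: "s @ [n] \<in> ?S" "n \<noteq> m"
        using infinite_imp_nonempty by blast
      then show False
        using bspec[OF s'(2)[unfolded comparable_with_all_def] n(1)] r by (auto simp: prefix_Cons)
    qed
  qed
  with tree succ show ?thesis unfolding laver_tree_def by blast
qed

lemma incr_fin_succ_mem:
  assumes "t \<in> incr_fin"
  shows "{n. t @ [n] \<in> incr_fin} \<in> U"
proof -
  have "{Suc (Max (insert 0 (set t)))..} \<subseteq> {n. t @ [n] \<in> incr_fin}"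
    using assms by (auto simp: incr_fin_def sorted_wrt_append Suc_le_eq)
  then show ?thesis using mem_mono atLeast_mem by blast
qed

lemma is_tree_incr_fin: "is_tree incr_fin"
  by (auto simp: is_tree_def incr_fin_def prefix_def sorted_wrt_append)

lemma laver_tree_guided:
  assumes "s \<in> incr_fin" "\<And>t. \<phi> t \<in> U"
  shows "laver_tree U (incr_fin \<inter> guided_nodes s \<phi>)"
  using laver_tree_restrict[OF is_tree_incr_fin] assms incr_fin_succ_mem by blast

text \<open>The assignment reads off the successor sets of \<open>S\<close>; a sequence through the
  stem that obeys it never leaves \<open>S\<close>.\<close>

lemma guided_branches_subset_branches:
  assumes "laver_tree U S" "is_stem S s" "\<And>t. t \<in> S \<Longrightarrow> prefix s t \<Longrightarrow> {n. t @ [n] \<in> S} \<in> U"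
  shows "\<exists>\<phi>. (\<forall>t. \<phi> t \<in> U) \<and> guided_branches s \<phi> \<subseteq> branches S"
proof -
  \<comment> \<open>\<open>UNIV\<close> is a default that keeps all values in \<open>U\<close>;
    guided branches never leave the nodes where the first case applies.\<close>
  define \<phi> where "\<phi> t = (if t \<in> S \<and> prefix s t then {n. t @ [n] \<in> S} else UNIV)" for t
  have S: "is_tree S" "s \<in> S" using assms unfolding laver_tree_def is_stem_def by auto
  have "\<phi> t \<in> U" for t using assms(3) UNIV_mem by (simp add: \<phi>_def)
  moreover have "guided_branches s \<phi> \<subseteq> branches S"
  proof
    fix x assume "x \<in> guided_branches s \<phi>"
    then have x: "x \<in> incr_inf" "map x [0..<length s] = s"
      "\<And>i. i \<ge> length s \<Longrightarrow> x i \<in> \<phi> (map x [0..<i])"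
      by (auto simp: guided_branches_def)
    have above: "map x [0..<n] \<in> S \<and> prefix s (map x [0..<n])" if "n \<ge> length s" for n
      using that
    proof (induction n rule: dec_induct)
      case base
      then show ?case using S x(2) by simp
    next
      case (step n)
      then show ?case using x(3)[of n] by (auto simp: \<phi>_def)
    qed
    have "map x [0..<n] \<in> S" for n
    proof (cases "n \<ge> length s")
      case False
      then have "prefix (map x [0..<n]) (map x [0..<length s])"
        by (metis map_mono_prefix nat_le_linear le_add_diff_inverse prefixI upt_add_eq_append zero_le)
      then show ?thesis using S x(2) unfolding is_tree_def by metis
    qed (use above in blast)
    then show "x \<in> branches S" using x(1) by (simp add: branches_def)
  qed
  ultimately show ?thesis by blast
qed

section \<open>Characterization of the ideal by followers\<close>

text \<open>Assignments for \<open>U\<close>-many successors of \<open>s\<close> are glued into one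
  for \<open>s\<close>: the first entry after \<open>s\<close> decides which of them is
  obeyed.\<close>

lemma guided_branches_amalgamate:
  assumes "{n. \<exists>\<phi>. (\<forall>t. \<phi> t \<in> U) \<and> X \<inter> guided_branches (s @ [n]) \<phi> = {}} \<in> U"
  shows "\<exists>\<phi>. (\<forall>t. \<phi> t \<in> U) \<and> X \<inter> guided_branches s \<phi> = {}"
proof -
  let ?G = "{n. \<exists>\<phi>. (\<forall>t. \<phi> t \<in> U) \<and> X \<inter> guided_branches (s @ [n]) \<phi> = {}}"
  have "\<forall>n\<in>?G. \<exists>\<phi>. (\<forall>t. \<phi> t \<in> U) \<and> X \<inter> guided_branches (s @ [n]) \<phi> = {}"
    by simp
  from bchoice[OF this] obtain \<Phi> where
    \<Phi>: "\<And>n. n \<in> ?G \<Longrightarrow> (\<forall>t. \<Phi> n t \<in> U) \<and> X \<inter> guided_branches (s @ [n]) (\<Phi> n) = {}"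
    by blast
  \<comment> \<open>The first case matters at \<open>s\<close> itself and forces the next entry into
    \<open>?G\<close>; above \<open>s\<close>, the entry \<open>t ! length s\<close> selects the
    assignment, with \<open>UNIV\<close> as default.\<close>
  define \<phi> where "\<phi> t = (if length t \<le> length s then ?G
      else if t ! length s \<in> ?G then \<Phi> (t ! length s) t else UNIV)" for t
  have "\<phi> t \<in> U" for t using \<Phi> assms UNIV_mem by (simp add: \<phi>_def)
  moreover have False if "x \<in> X" "x \<in> guided_branches s \<phi>" for x
  proof -
    let ?n = "x (length s)"
    have x: "x \<in> incr_inf" "map x [0..<length s] = s"
      "\<And>i. i \<ge> length s \<Longrightarrow> x i \<in> \<phi> (map x [0..<i])"
      using that by (auto simp: guided_branches_def)
    have n: "?n \<in> ?G" using x(3)[of "length s"] by (simp add: \<phi>_def)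
    have "x i \<in> \<Phi> ?n (map x [0..<i])" if "i \<ge> Suc (length s)" for i
    proof -
      have "map x [0..<i] ! length s = ?n" using that by simp
      then show ?thesis using x(3)[of i] that n unfolding \<phi>_def by simp
    qed
    then have "x \<in> guided_branches (s @ [?n]) (\<Phi> ?n)" using x by (simp add: guided_branches_def)
    then show False using \<Phi>[OF n] that(1) by blast
  qed
  ultimately show ?thesis by blast
qed

text \<open>
  Otherwise, since \<open>U\<close> is an ultrafilter, \<open>U\<close>-many successors of a node for which this fails also
  fail, so above \<open>s\<close> the failing nodes contain a Laver tree; but the stem of a Laver subtree
  avoiding \<open>X\<close> does not fail.
\<close>

lemma laver_ideal_avoids_guided_branches:
  assumes X: "X \<in> laver_ideal U"
  shows "\<exists>\<phi>. (\<forall>t. \<phi> t \<in> U) \<and> X \<inter> guided_branches s \<phi> = {}"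
proof (rule ccontr)
  define good where "good t \<longleftrightarrow> (\<exists>\<phi>. (\<forall>t. \<phi> t \<in> U) \<and> X \<inter> guided_branches t \<phi> = {})" for t
  assume "\<not> ?thesis"
  then have bad: "\<not> good s" by (simp add: good_def)
  \<comment> \<open>At a node that is not good, the gluing lemma keeps the set of good successors
    out of \<open>U\<close>, so its complement is in \<open>U\<close>.\<close>
  define \<phi> where "\<phi> t = (if good t then UNIV else - {n. good (t @ [n])})" for t
  have \<phi>: "\<phi> t \<in> U" for t
    using guided_branches_amalgamate[of X t] not_mem_compl[of "{n. good (t @ [n])}"] UNIV_mem
    by (auto simp: \<phi>_def good_def)
  \<comment> \<open>As \<open>s\<close> is not good, some strictly increasing sequence passes
    through it; this makes \<open>s\<close> increasing, as the stem of a Laver tree must be.\<close>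
  have "X \<inter> guided_branches s (\<lambda>_. UNIV) \<noteq> {}"
    using bad UNIV_mem unfolding good_def by metis
  then obtain x where "x \<in> guided_branches s (\<lambda>_. UNIV)" by blast
  then have "s = map x [0..<length s]" "strict_mono x" by (auto simp: guided_branches_def incr_inf_def)
  then have s: "s \<in> incr_fin"
    by (metis (no_types, lifting) incr_fin_def mem_Collect_eq sorted_wrt_map
        sorted_wrt_mono_rel sorted_wrt_upt strict_mono_less)
  let ?T = "incr_fin \<inter> guided_nodes s \<phi>"
  have "laver_tree U ?T" using laver_tree_guided s \<phi> by blast
  then obtain S where S: "laver_tree U S" "S \<subseteq> ?T" "X \<inter> branches S = {}"
    using X unfolding laver_ideal_def by blast
  obtain t where t: "is_stem S t" "\<And>u. u \<in> S \<Longrightarrow> prefix t u \<Longrightarrow> {n. u @ [n] \<in> S} \<in> U"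
    using S(1) unfolding laver_tree_def by blast
  have "good t"
    using guided_branches_subset_branches[OF S(1) t] S(3) unfolding good_def by blast
  have tS: "t \<in> S" using t(1) by (simp add: is_stem_def)
  have "prefix s t"
  proof (rule ccontr)
    assume np: "\<not> prefix s t"
    then have "strict_prefix t s" using tS S(2) by (auto simp: guided_nodes_def)
    then obtain m r where r: "s = t @ m # r" by (rule strict_prefixE')
    \<comment> \<open>A proper initial segment of \<open>s\<close> has at most one successor
      comparable with \<open>s\<close>, too few for a member of \<open>U\<close>.\<close>
    have "{n. t @ [n] \<in> S} \<subseteq> {m}"
      using S(2) r by (auto simp: guided_nodes_def)
    then show False
      using mem_infinite[OF t(2)[OF tS]] finite_subset by blast
  qed
  have nodes: "u \<in> guided_nodes s \<phi> \<Longrightarrow> prefix s u \<Longrightarrow> \<not> good u" for u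
  proof (induction u rule: rev_induct)
    case Nil
    then show ?case using bad by simp
  next
    case (snoc n u)
    show ?case
    proof (cases "prefix s u")
      case True
      have "u \<in> guided_nodes s \<phi>"
        using guided_nodes_prefix_closed[OF snoc.prems(1)] by simp
      then have "\<not> good u" using snoc.IH True by blast
      moreover have "n \<in> \<phi> u"
        using guided_nodes_snoc[OF \<open>u \<in> guided_nodes s \<phi>\<close> True] snoc.prems(1) by blast
      ultimately show ?thesis by (simp add: \<phi>_def)
    next
      case False
      then have "u @ [n] = s" using snoc.prems(2) by (simp add: prefix_snoc)
      then show ?thesis using bad by simp
    qed
  qed
  show False using nodes[of t] \<open>good t\<close> \<open>prefix s t\<close> tS S(2) by blast
qed

text \<open>Left to right, the assignments avoiding \<open>X\<close> above each single
  \<open>s\<close> are merged. Conversely, thinning a Laver tree above its stem by \<phi> leaves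
  only branches that follow \<phi>.\<close>

lemma laver_ideal_iff:
  "X \<in> laver_ideal U \<longleftrightarrow> X \<subseteq> incr_inf \<and> (\<exists>\<phi>. (\<forall>t. \<phi> t \<in> U) \<and> X \<inter> followers \<phi> = {})"
proof
  assume X: "X \<in> laver_ideal U"
  obtain \<Phi> where \<Phi>: "\<And>s t. \<Phi> s t \<in> U" "\<And>s. X \<inter> guided_branches s (\<Phi> s) = {}"
    using laver_ideal_avoids_guided_branches[OF X] by metis
  \<comment> \<open>Only the finitely many initial segments of \<open>t\<close> are consulted, so
    the intersection stays in \<open>U\<close>; a follower that obeys \<phi> from \<open>m\<close>
    on obeys the assignment belonging to its own segment of length \<open>m\<close>.\<close>
  define \<phi> where "\<phi> t = (\<Inter>k\<le>length t. \<Phi> (take k t) t)" for t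
  have "\<phi> t \<in> U" for t using \<Phi>(1) INT_atMost_mem by (simp add: \<phi>_def)
  moreover have "x \<notin> X" if follows: "x \<in> followers \<phi>" for x
  proof -
    obtain m where x: "x \<in> incr_inf" "\<And>n. n \<ge> m \<Longrightarrow> x n \<in> \<phi> (map x [0..<n])"
      using follows by (auto simp: followers_def eventually_sequentially)
    let ?s = "map x [0..<m]"
    have "x n \<in> \<Phi> ?s (map x [0..<n])" if "n \<ge> m" for n
    proof -
      have "x n \<in> \<Phi> (take m (map x [0..<n])) (map x [0..<n])"
        using x(2)[OF that] that by (simp add: \<phi>_def)
      then show ?thesis using that by (simp add: take_map)
    qed
    then have "x \<in> guided_branches ?s (\<Phi> ?s)" using x(1) by (simp add: guided_branches_def)
    then show ?thesis using \<Phi>(2) by blast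
  qed
  moreover have "X \<subseteq> incr_inf" using X by (simp add: laver_ideal_def)
  ultimately show "X \<subseteq> incr_inf \<and> (\<exists>\<phi>. (\<forall>t. \<phi> t \<in> U) \<and> X \<inter> followers \<phi> = {})" by blast
next
  assume "X \<subseteq> incr_inf \<and> (\<exists>\<phi>. (\<forall>t. \<phi> t \<in> U) \<and> X \<inter> followers \<phi> = {})"
  then obtain \<phi> where X: "X \<subseteq> incr_inf" "\<And>t. \<phi> t \<in> U" "X \<inter> followers \<phi> = {}" by blast
  have "\<exists>S. laver_tree U S \<and> S \<subseteq> T \<and> X \<inter> branches S = {}"
    if T: "laver_tree U T" for T
  proof -
    obtain s where s: "is_stem T s" "\<And>t. t \<in> T \<Longrightarrow> prefix s t \<Longrightarrow> {n. t @ [n] \<in> T} \<in> U"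
      and "is_tree T"
      using T unfolding laver_tree_def by blast
    let ?S = "T \<inter> guided_nodes s \<phi>"
    have "laver_tree U ?S"
      using laver_tree_restrict[OF \<open>is_tree T\<close> _ s(2) X(2)] s(1) by (simp add: is_stem_def)
    moreover have "X \<inter> branches ?S = {}"
      using branches_guided_subset_followers[of ?S s \<phi>] X(3) by blast
    ultimately show ?thesis by blast
  qed
  with X(1) show "X \<in> laver_ideal U" by (simp add: laver_ideal_def)
qed

lemma laver_idealE:
  assumes "X \<in> laver_ideal U"
  obtains \<phi> where "\<forall>t. \<phi> t \<in> U" "X \<inter> followers \<phi> = {}"
  using assms unfolding laver_ideal_iff by metis

lemma exists_follower_of_not_mem:
  assumes "X \<subseteq> incr_inf" "X \<notin> laver_ideal U" "\<And>t. \<phi> t \<in> U"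
  shows "\<exists>x\<in>X. x \<in> followers \<phi>"
  using assms unfolding laver_ideal_iff by (metis disjoint_iff)

lemma compl_followers_mem: "(\<And>t. \<phi> t \<in> U) \<Longrightarrow> incr_inf - followers \<phi> \<in> laver_ideal U"
  unfolding laver_ideal_iff by (intro conjI exI[of _ \<phi>]) auto

lemma exists_follower_in_ultrafilter: "(\<And>t. \<phi> t \<in> U) \<Longrightarrow> followers \<phi> \<noteq> {}"
  using exists_follower[of \<phi>] mem_infinite by blast

lemma incr_inf_not_mem: "incr_inf \<notin> laver_ideal U"
proof
  assume "incr_inf \<in> laver_ideal U"
  then obtain \<phi> where "\<forall>t. \<phi> t \<in> U" "incr_inf \<inter> followers \<phi> = {}" by (rule laver_idealE)
  then show False
    using exists_follower_in_ultrafilter[of \<phi>] followers_subset_incr_inf[of \<phi>] by blast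
qed

lemma laver_ideal_choose:
  assumes "C \<subseteq> laver_ideal U"
  obtains \<Phi> where "\<And>X t. X \<in> C \<Longrightarrow> \<Phi> X t \<in> U"
    and "\<And>X. X \<in> C \<Longrightarrow> X \<subseteq> incr_inf" and "\<And>X. X \<in> C \<Longrightarrow> X \<inter> followers (\<Phi> X) = {}"
proof -
  have "\<exists>\<phi>. X \<subseteq> incr_inf \<and> (\<forall>t. \<phi> t \<in> U) \<and> X \<inter> followers \<phi> = {}" if "X \<in> C" for X
    using subsetD[OF assms that] unfolding laver_ideal_iff by blast
  then show thesis using that by metis
qed

section \<open>Countable subfamilies of the ultrafilter\<close>

text \<open>Replaces a countable family by a sequence, so that almost containing some member becomes
  a condition on all large \<open>m\<close>, the form that the threshold lemmas need.\<close>

lemma countable_refinement: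
  assumes "countable \<B>" "\<B> \<subseteq> U"
  shows "\<exists>D. (\<forall>n. D n \<in> U) \<and>
    (\<forall>A. (\<exists>B\<in>\<B>. B \<subseteq>* A) \<longrightarrow> (\<forall>\<^sub>F m in sequentially. D m \<subseteq> A))"
proof -
  \<comment> \<open>Inserting \<open>UNIV\<close> allows an enumeration even when \<B> is
    empty.\<close>
  define b where "b = from_nat_into (insert UNIV \<B>)"
  have b: "range b = insert UNIV \<B>"
    unfolding b_def using assms(1) by (intro range_from_nat_into) auto
  then have bU: "b k \<in> U" for k using assms(2) UNIV_mem by (metis insert_iff rangeI subsetD)
  \<comment> \<open>For large \<open>n\<close> the intersection lies inside any given
    \<open>B\<close>, and the tail removes the finite set \<open>B - A\<close>.\<close>
  define D where "D n = (\<Inter>k\<le>n. b k) \<inter> {n..}" for n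
  have "D n \<in> U" for n unfolding D_def using bU by (intro Int_mem INT_atMost_mem atLeast_mem)
  moreover have "\<forall>\<^sub>F m in sequentially. D m \<subseteq> A" if B: "B \<in> \<B>" "B \<subseteq>* A" for A B
  proof -
    obtain k where k: "B = b k" using b B(1) by blast
    show ?thesis
      using almost_subset_cut_eventually[OF B(2)] eventually_ge_at_top[of k]
      by eventually_elim (auto simp: D_def k)
  qed
  ultimately show ?thesis by blast
qed

text \<open>With \<open>D\<close> from the refinement, the value at \<open>t\<close> depends on its
  length only. The range of every follower is then a pseudo-intersection of \<B>.\<close>

lemma countable_diagonal:
  assumes "countable \<B>" "\<B> \<subseteq> U"
  shows "\<exists>\<phi>. (\<forall>t. \<phi> t \<in> U) \<and>
    (\<forall>x\<in>followers \<phi>. \<forall>B\<in>\<B>. \<forall>\<^sub>F n in sequentially. x n \<in> B)"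
proof -
  obtain D where D: "\<And>n. D n \<in> U"
    "\<And>A B. B \<in> \<B> \<Longrightarrow> B \<subseteq>* A \<Longrightarrow> \<forall>\<^sub>F m in sequentially. D m \<subseteq> A"
    using countable_refinement[OF assms] by blast
  have "\<forall>\<^sub>F n in sequentially. x n \<in> B" if "x \<in> followers (\<lambda>t. D (length t))" "B \<in> \<B>" for x B
  proof -
    have "\<forall>\<^sub>F m in sequentially. D m \<subseteq> B" using D(2)[OF that(2)] by (simp add: almost_subset_def)
    moreover have "\<forall>\<^sub>F n in sequentially. x n \<in> D n" using that(1) by (simp add: followers_def)
    ultimately show ?thesis by eventually_elim auto
  qed
  with D(1) show ?thesis by (intro exI[of _ "\<lambda>t. D (length t)"]) blast
qed

text \<open>Entries are chosen from the infinite sets \<open>\<psi> t - A\<close>. This is how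
  almost inclusions are recovered from facts about followers.\<close>

lemma exists_follower_avoiding:
  assumes "\<And>t. \<not> \<psi> t \<subseteq>* A"
  shows "\<exists>x\<in>followers \<psi>. \<forall>n. x n \<notin> A"
proof -
  have "infinite (\<psi> t - A)" for t using assms by (simp add: almost_subset_def)
  then obtain x where x: "x \<in> followers (\<lambda>t. \<psi> t - A)" "\<And>n. x n \<in> \<psi> (map x [0..<n]) - A"
    using exists_follower[of "\<lambda>t. \<psi> t - A"] by blast
  moreover have "followers (\<lambda>t. \<psi> t - A) \<subseteq> followers \<psi>" by (rule followers_mono) auto
  ultimately show ?thesis by blast
qed

section \<open>The four invariants\<close>

text \<open>Abbreviations, so that they agree literally with the properties exposed by unfolding the
  cardinals.\<close>

abbreviation "p_prime_witness \<A> \<equiv> \<A> \<subseteq> U \<and>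
  (\<forall>\<B>. countable \<B> \<and> \<B> \<subseteq> U \<longrightarrow> (\<exists>A\<in>\<A>. \<forall>B\<in>\<B>. \<not> B \<subseteq>* A))"

abbreviation "pi_p_witness \<A> \<equiv> \<A> \<subseteq> U \<and> \<not> (\<exists>B. infinite B \<and> (\<forall>A\<in>\<A>. B \<subseteq>* A))"

abbreviation "pi_chi_sigma_witness \<A> \<equiv> \<A> \<subseteq> {A. infinite A} \<and>
  (\<forall>\<B>. countable \<B> \<and> \<B> \<subseteq> U \<longrightarrow> (\<exists>A\<in>\<A>. \<forall>B\<in>\<B>. A \<subseteq>* B))"

abbreviation "chi_sigma_witness \<AA> \<equiv> \<AA> \<subseteq> {\<A>. countable \<A> \<and> \<A> \<subseteq> U} \<and>
  (\<forall>\<B>. countable \<B> \<and> \<B> \<subseteq> U \<longrightarrow> (\<exists>\<A>\<in>\<AA>. \<forall>B\<in>\<B>. \<exists>A\<in>\<A>. A \<subseteq>* B))"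

abbreviation "unbounded F \<equiv> \<not> (\<exists>g. \<forall>f\<in>F. f \<le>* g)"

abbreviation "dominating D \<equiv> \<forall>g. \<exists>f\<in>D. g \<le>* f"

section \<open>Existence of the families over which the minima are taken\<close>

lemma exists_unbounded: "unbounded UNIV"
proof
  assume "\<exists>g. \<forall>f\<in>UNIV. f \<le>* g"
  then obtain g where "(\<lambda>n. Suc (g n)) \<le>* g" by blast
  then show False by (auto simp: eventually_le_def eventually_sequentially)
qed

lemma exists_dominating: "dominating UNIV"
proof
  fix g
  have "g \<le>* g" by (simp add: eventually_le_def)
  then show "\<exists>f\<in>UNIV. g \<le>* f" by blast
qed

text \<open>Enumerate \<open>B\<close> and split it into the elements at even and at odd positions.
  \<open>U\<close> contains the even half or its complement, and either one misses infinitely many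
  elements of \<open>B\<close>.\<close>

lemma exists_mem_not_almost_containing:
  assumes "infinite B"
  shows "\<exists>A\<in>U. \<not> B \<subseteq>* A"
proof -
  define e where "e = enumerate B"
  have e: "strict_mono e" "\<And>n. e n \<in> B"
    using assms by (simp_all add: e_def enumerate_in_set strict_mono_enumerate)
  then have "inj e" by (simp add: strict_mono_imp_inj_on)
  let ?E = "e ` {n. even n}" and ?O = "e ` {n. odd n}"
  have "\<exists>n\<ge>m. even n" "\<exists>n\<ge>m. odd n" for m :: nat
    by (rule exI[of _ "2 * m"], simp) (rule exI[of _ "Suc (2 * m)"], simp)
  then have "infinite {n::nat. even n}" "infinite {n::nat. odd n}"
    by (simp_all add: infinite_nat_iff_unbounded_le)
  then have inf: "infinite ?E" "infinite ?O"
    using \<open>inj e\<close> finite_imageD inj_on_subset by blast+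
  have "?E \<inter> ?O = {}" using \<open>inj e\<close> by (auto dest: injD)
  then have "?E \<subseteq> B - - ?E" "?O \<subseteq> B - ?E" using e(2) by auto
  then have "\<not> B \<subseteq>* ?E" "\<not> B \<subseteq>* - ?E"
    using inf finite_subset unfolding almost_subset_def by blast+
  then show ?thesis using mem_or_compl_mem by blast
qed

lemma pi_p_witness_ultrafilter: "pi_p_witness U"
  using exists_mem_not_almost_containing by blast

text \<open>Take the range of a diagonal follower for \<B> and an \<open>A\<close> in
  \<open>U\<close> that does not almost contain it. As this range is almost contained in every
  \<open>B\<close> in \<B>, no such \<open>B\<close> is almost contained in
  \<open>A\<close>.\<close>

lemma p_prime_witness_ultrafilter: "p_prime_witness U"
proof (intro conjI allI impI)
  fix \<B> assume \<B>: "countable \<B> \<and> \<B> \<subseteq> U"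
  obtain \<phi> where \<phi>: "\<And>t. \<phi> t \<in> U"
    "\<And>x B. x \<in> followers \<phi> \<Longrightarrow> B \<in> \<B> \<Longrightarrow> \<forall>\<^sub>F n in sequentially. x n \<in> B"
    using countable_diagonal \<B> by metis
  obtain x where x: "x \<in> followers \<phi>" using exists_follower_in_ultrafilter[of \<phi>] \<phi>(1) by blast
  then obtain A where A: "A \<in> U" "\<not> range x \<subseteq>* A"
    using exists_mem_not_almost_containing infinite_range_incr_inf followers_subset_incr_inf by blast
  have "\<not> B \<subseteq>* A" if "B \<in> \<B>" for B
  proof
    assume "B \<subseteq>* A"
    then have "finite ((range x - B) \<union> (B - A))"
      using range_almost_subset[OF \<phi>(2)[OF x that]] by (simp add: almost_subset_def)
    then have "finite (range x - A)" by (rule finite_subset[rotated]) auto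
    then show False using A(2) by (simp add: almost_subset_def)
  qed
  with A(1) show "\<exists>A\<in>U. \<forall>B\<in>\<B>. \<not> B \<subseteq>* A" by blast
qed simp

lemma pi_chi_sigma_witness_infinite_sets: "pi_chi_sigma_witness {A. infinite A}"
proof (intro conjI allI impI)
  fix \<B> assume \<B>: "countable \<B> \<and> \<B> \<subseteq> U"
  obtain \<phi> where \<phi>: "\<And>t. \<phi> t \<in> U"
    "\<And>x B. x \<in> followers \<phi> \<Longrightarrow> B \<in> \<B> \<Longrightarrow> \<forall>\<^sub>F n in sequentially. x n \<in> B"
    using countable_diagonal \<B> by metis
  obtain x where x: "x \<in> followers \<phi>" using exists_follower_in_ultrafilter[of \<phi>] \<phi>(1) by blast
  then have "infinite (range x)"
    using infinite_range_incr_inf followers_subset_incr_inf by blast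
  moreover have "\<forall>B\<in>\<B>. range x \<subseteq>* B" using \<phi>(2)[OF x] range_almost_subset by blast
  ultimately show "\<exists>A\<in>{A. infinite A}. \<forall>B\<in>\<B>. A \<subseteq>* B" by blast
qed simp

lemma chi_sigma_witness_countable_sets: "chi_sigma_witness {\<A>. countable \<A> \<and> \<A> \<subseteq> U}"
proof (intro conjI allI impI)
  fix \<B> assume "countable \<B> \<and> \<B> \<subseteq> U"
  moreover have "\<forall>B\<in>\<B>. \<exists>A\<in>\<B>. A \<subseteq>* B"
    unfolding almost_subset_def by (metis Diff_cancel finite.emptyI)
  ultimately show "\<exists>\<A>\<in>{\<A>. countable \<A> \<and> \<A> \<subseteq> U}. \<forall>B\<in>\<B>. \<exists>A\<in>\<A>. A \<subseteq>* B" by blast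
qed simp

section \<open>Additivity and covering\<close>

text \<open>For each \<open>f\<close>, the increasing sequences that do not eventually dominate
  \<open>f\<close> form a set in the ideal; unboundedness says exactly that every sequence lies in
  one of them.\<close>

lemma cover_of_unbounded:
  assumes "unbounded F"
  shows "\<exists>C. C \<subseteq> laver_ideal U \<and> incr_inf \<subseteq> \<Union>C \<and> |C| \<le>o |F|"
proof (intro exI conjI)
  let ?N = "\<lambda>f. incr_inf - followers (\<lambda>s. {f (length s)..})"
  show "?N ` F \<subseteq> laver_ideal U"
    by (intro image_subsetI compl_followers_mem atLeast_mem)
  show "incr_inf \<subseteq> \<Union>(?N ` F)"
  proof
    fix x assume "x \<in> incr_inf"
    moreover obtain f where "f \<in> F" "\<not> f \<le>* x" using assms by blast
    ultimately show "x \<in> \<Union>(?N ` F)" by (intro UN_I[of f]) (simp_all add: followers_length_iff)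
  qed
  show "|?N ` F| \<le>o |F|" by (rule card_of_image)
qed

lemma add_witness_of_cover:
  "incr_inf \<subseteq> \<Union>C \<Longrightarrow> C \<subseteq> laver_ideal U \<Longrightarrow> \<Union>C \<notin> laver_ideal U"
  using incr_inf_not_mem laver_ideal_iff[of "\<Union>C"] by (metis subset_antisym)

text \<open>Given sets in the ideal, either the values of their assignments at some \<open>t\<close>
  witness \<open>p_prime\<close>, or each \<open>t\<close> has a sequence refining all these values.
  In the latter case a bound for the thresholds would give one assignment avoiding the whole
  union.\<close>

theorem add_laver_ideal:
  "add_ideal (laver_ideal U) =o card_min (p_prime U) bounding_number"
  unfolding add_ideal_def p_prime_def bounding_number_def
proof (rule least_card_eq_card_min[where Q = p_prime_witness and R = unbounded,
      OF p_prime_witness_ultrafilter exists_unbounded])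
  fix \<A> assume \<A>: "p_prime_witness \<A>"
  let ?N = "\<lambda>A. incr_inf - followers (\<lambda>_. A)"
  have "\<Union>(?N ` \<A>) \<notin> laver_ideal U"
  proof
    assume "\<Union>(?N ` \<A>) \<in> laver_ideal U"
    then obtain \<psi> where \<psi>: "\<forall>t. \<psi> t \<in> U" "\<Union>(?N ` \<A>) \<inter> followers \<psi> = {}"
      by (rule laver_idealE)
    \<comment> \<open>There are only countably many finite sequences, so an assignment is itself a
      countable subfamily of \<open>U\<close>.\<close>
    have "countable (range \<psi>) \<and> range \<psi> \<subseteq> U" using \<psi>(1) by auto
    with \<A>[THEN conjunct2, rule_format]
    have "\<exists>A\<in>\<A>. \<forall>B\<in>range \<psi>. \<not> B \<subseteq>* A" .
    then obtain A where A: "A \<in> \<A>" "\<And>t. \<not> \<psi> t \<subseteq>* A" by auto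
    obtain x where x: "x \<in> followers \<psi>" "\<And>n. x n \<notin> A"
      using exists_follower_avoiding A(2) by blast
    then have "x \<in> ?N A"
      using followers_subset_incr_inf by (auto simp: followers_def)
    then show False using A(1) x(1) \<psi>(2) by blast
  qed
  moreover have "?N ` \<A> \<subseteq> laver_ideal U"
    using \<A> by (intro image_subsetI compl_followers_mem) blast
  ultimately show "\<exists>C. (C \<subseteq> laver_ideal U \<and> \<Union>C \<notin> laver_ideal U) \<and> |C| \<le>o |\<A>|"
    by (intro exI[of _ "?N ` \<A>"] conjI card_of_image) blast+
next
  fix F :: "(nat \<Rightarrow> nat) set" assume "unbounded F"
  then show "\<exists>C. (C \<subseteq> laver_ideal U \<and> \<Union>C \<notin> laver_ideal U) \<and> |C| \<le>o |F|"
    using cover_of_unbounded[of F] add_witness_of_cover by (simp add: conj_assoc) metis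
next
  fix C assume C: "C \<subseteq> laver_ideal U \<and> \<Union>C \<notin> laver_ideal U"
  then obtain \<Phi> where \<Phi>: "\<And>X t. X \<in> C \<Longrightarrow> \<Phi> X t \<in> U"
    "\<And>X. X \<in> C \<Longrightarrow> X \<subseteq> incr_inf" "\<And>X. X \<in> C \<Longrightarrow> X \<inter> followers (\<Phi> X) = {}"
    using laver_ideal_choose by metis
  show "(\<exists>\<A>. p_prime_witness \<A> \<and> |\<A>| \<le>o |C| ) \<or> (\<exists>F. unbounded F \<and> |F| \<le>o |C| )"
  proof (cases "\<exists>t. p_prime_witness ((\<lambda>X. \<Phi> X t) ` C)")
    case True
    then obtain t where "p_prime_witness ((\<lambda>X. \<Phi> X t) ` C)" ..
    then show ?thesis
      by (intro disjI1 exI[of _ "(\<lambda>X. \<Phi> X t) ` C"] conjI[OF _ card_of_image])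
  next
    case False
    have base: "\<exists>\<B>. countable \<B> \<and> \<B> \<subseteq> U \<and> (\<forall>X\<in>C. \<exists>B\<in>\<B>. B \<subseteq>* \<Phi> X t)" for t
    proof -
      have "(\<lambda>X. \<Phi> X t) ` C \<subseteq> U" using \<Phi>(1) by blast
      with False show ?thesis by auto
    qed
    have "\<exists>D. (\<forall>n. D n \<in> U) \<and> (\<forall>X\<in>C. \<forall>\<^sub>F m in sequentially. D m \<subseteq> \<Phi> X t)" for t
    proof -
      obtain \<B> where \<B>: "countable \<B>" "\<B> \<subseteq> U" "\<forall>X\<in>C. \<exists>B\<in>\<B>. B \<subseteq>* \<Phi> X t"
        using base[of t] by blast
      from countable_refinement[OF \<B>(1,2)] \<B>(3) show ?thesis by (elim exE) blast
    qed
    then obtain D where D: "\<And>t n. D t n \<in> U"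
      "\<And>X t. X \<in> C \<Longrightarrow> \<forall>\<^sub>F m in sequentially. D t m \<subseteq> \<Phi> X t" by metis
    from unbounded_or_uniform_threshold[of C "\<lambda>X t m. D t m \<subseteq> \<Phi> X t", OF D(2)]
    show ?thesis
    proof
      assume "\<exists>F. unbounded F \<and> |F| \<le>o |C|"
      then show ?thesis by (rule disjI2)
    next
      assume "\<exists>g. \<forall>X\<in>C. finite {t. \<not> D t (g t) \<subseteq> \<Phi> X t}"
      then obtain g where "\<forall>X\<in>C. finite {t. \<not> D t (g t) \<subseteq> \<Phi> X t}" ..
      then have "X \<inter> followers (\<lambda>t. D t (g t)) = {}" if "X \<in> C" for X
        using followers_mono[of "\<lambda>t. D t (g t)" "\<Phi> X"] \<Phi>(3) that by blast
      moreover have "\<Union>C \<subseteq> incr_inf" using \<Phi>(2) by blast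
      ultimately have "\<Union>C \<in> laver_ideal U"
        unfolding laver_ideal_iff using D(1) by (intro conjI exI[of _ "\<lambda>t. D t (g t)"]) auto
      with C show ?thesis by simp
    qed
  qed
qed

text \<open>As for additivity, with a pseudo-intersection \<open>B t\<close> in place of a refining
  sequence. It need not lie in \<open>U\<close>: being infinite is enough to produce one follower,
  and one uncovered point refutes a cover.\<close>

theorem cov_laver_ideal:
  "cov_ideal incr_inf (laver_ideal U) =o card_min (pi_p U) bounding_number"
  unfolding cov_ideal_def pi_p_def bounding_number_def
proof (rule least_card_eq_card_min[where Q = pi_p_witness and R = unbounded,
      OF pi_p_witness_ultrafilter exists_unbounded])
  fix \<A> assume \<A>: "pi_p_witness \<A>"
  let ?N = "\<lambda>A. incr_inf - followers (\<lambda>_. A)"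
  have "?N ` \<A> \<subseteq> laver_ideal U"
    using \<A> by (intro image_subsetI compl_followers_mem) blast
  moreover have "incr_inf \<subseteq> \<Union>(?N ` \<A>)"
  proof
    fix x assume x: "x \<in> incr_inf"
    then obtain A where "A \<in> \<A>" "\<not> range x \<subseteq>* A"
      using \<A> infinite_range_incr_inf by blast
    then show "x \<in> \<Union>(?N ` \<A>)" using x by (intro UN_I[of A]) (simp_all add: followers_const_iff)
  qed
  ultimately show "\<exists>C. (C \<subseteq> laver_ideal U \<and> incr_inf \<subseteq> \<Union>C) \<and> |C| \<le>o |\<A>|"
    by (intro exI[of _ "?N ` \<A>"] conjI card_of_image) blast+
next
  fix F :: "(nat \<Rightarrow> nat) set" assume "unbounded F"
  then show "\<exists>C. (C \<subseteq> laver_ideal U \<and> incr_inf \<subseteq> \<Union>C) \<and> |C| \<le>o |F|"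
    using cover_of_unbounded[of F] by (simp add: conj_assoc)
next
  fix C assume C: "C \<subseteq> laver_ideal U \<and> incr_inf \<subseteq> \<Union>C"
  then obtain \<Phi> where \<Phi>: "\<And>X t. X \<in> C \<Longrightarrow> \<Phi> X t \<in> U"
    "\<And>X. X \<in> C \<Longrightarrow> X \<inter> followers (\<Phi> X) = {}"
    using laver_ideal_choose by metis
  show "(\<exists>\<A>. pi_p_witness \<A> \<and> |\<A>| \<le>o |C| ) \<or> (\<exists>F. unbounded F \<and> |F| \<le>o |C| )"
  proof (cases "\<exists>t. pi_p_witness ((\<lambda>X. \<Phi> X t) ` C)")
    case True
    then obtain t where "pi_p_witness ((\<lambda>X. \<Phi> X t) ` C)" ..
    then show ?thesis
      by (intro disjI1 exI[of _ "(\<lambda>X. \<Phi> X t) ` C"] conjI[OF _ card_of_image])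
  next
    case False
    have "\<exists>B. infinite B \<and> (\<forall>X\<in>C. B \<subseteq>* \<Phi> X t)" for t
    proof -
      have "(\<lambda>X. \<Phi> X t) ` C \<subseteq> U" using \<Phi>(1) by blast
      with False show ?thesis by auto
    qed
    then obtain B where B: "\<And>t. infinite (B t)" "\<And>X t. X \<in> C \<Longrightarrow> B t \<subseteq>* \<Phi> X t" by metis
    from unbounded_or_uniform_threshold[of C "\<lambda>X t m. B t \<inter> {m..} \<subseteq> \<Phi> X t",
        OF almost_subset_cut_eventually[OF B(2)]]
    show ?thesis
    proof
      assume "\<exists>F. unbounded F \<and> |F| \<le>o |C|"
      then show ?thesis by (rule disjI2)
    next
      assume "\<exists>g. \<forall>X\<in>C. finite {t. \<not> B t \<inter> {g t..} \<subseteq> \<Phi> X t}"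
      then obtain g where g: "\<forall>X\<in>C. finite {t. \<not> B t \<inter> {g t..} \<subseteq> \<Phi> X t}" ..
      obtain x where x: "x \<in> followers (\<lambda>t. B t \<inter> {g t..})"
        using exists_follower[of "\<lambda>t. B t \<inter> {g t..}"] infinite_cut B(1) by blast
      then have "x \<in> incr_inf" using followers_subset_incr_inf by blast
      then obtain X where X: "X \<in> C" "x \<in> X" using C by blast
      then have "x \<in> followers (\<Phi> X)"
        using followers_mono[of "\<lambda>t. B t \<inter> {g t..}" "\<Phi> X"] g x by blast
      with \<Phi>(2) X have False by blast
      then show ?thesis ..
    qed
  qed
qed

section \<open>Uniformity and cofinality\<close>

text \<open>A set outside the ideal meets the followers of every assignment, in particular of the
  one by tails given by \<open>f\<close>.\<close>

lemma dominating_of_not_mem: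
  assumes "X \<subseteq> incr_inf" "X \<notin> laver_ideal U"
  shows "dominating X"
proof
  fix f
  show "\<exists>x\<in>X. f \<le>* x"
    using exists_follower_of_not_mem[OF assms, of "\<lambda>s. {f (length s)..}"] atLeast_mem
    by (auto simp: followers_length_iff)
qed

text \<open>Below, the ranges of the members of \<open>X\<close> serve as the infinite sets, tested
  on diagonal followers. Above, one point is chosen for each pair of an infinite set and a
  function.\<close>

theorem non_laver_ideal:
  "non_ideal incr_inf (laver_ideal U) =o card_max (pi_chi_sigma U) dominating_number"
  unfolding non_ideal_def pi_chi_sigma_def dominating_number_def
proof (rule least_card_eq_card_max[where Q = pi_chi_sigma_witness and R = dominating,
      OF pi_chi_sigma_witness_infinite_sets exists_dominating])
  fix X assume X: "X \<subseteq> incr_inf \<and> X \<notin> laver_ideal U"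
  have guess: "\<exists>A\<in>range ` X. \<forall>B\<in>\<B>. A \<subseteq>* B"
    if \<B>: "countable \<B> \<and> \<B> \<subseteq> U" for \<B>
  proof -
    obtain \<phi> where \<phi>: "\<And>t. \<phi> t \<in> U"
      "\<And>x B. x \<in> followers \<phi> \<Longrightarrow> B \<in> \<B> \<Longrightarrow> \<forall>\<^sub>F n in sequentially. x n \<in> B"
      using countable_diagonal \<B> by metis
    obtain x where "x \<in> X" "x \<in> followers \<phi>"
      using exists_follower_of_not_mem[of X \<phi>] X \<phi>(1) by blast
    then show ?thesis using \<phi>(2) range_almost_subset by blast
  qed
  have "range ` X \<subseteq> {A. infinite A}" using X infinite_range_incr_inf by blast
  then have "pi_chi_sigma_witness (range ` X)" by (intro conjI allI impI) (assumption, rule guess)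
  then show "\<exists>\<A>. pi_chi_sigma_witness \<A> \<and> |\<A>| \<le>o |X|"
    by (intro exI[of _ "range ` X"] conjI[OF _ card_of_image])
  show "\<exists>D. dominating D \<and> |D| \<le>o |X|"
    using dominating_of_not_mem X ordLeq_reflexive[OF card_of_Well_order] by blast
next
  fix \<A> :: "nat set set" and D :: "(nat \<Rightarrow> nat) set"
  assume \<A>: "pi_chi_sigma_witness \<A>" and D: "dominating D"
  \<comment> \<open>One set \<open>A\<close> serves at every \<open>t\<close>; \<open>d\<close> only
    prescribes how much of it is cut off there.\<close>
  let ?\<psi> = "\<lambda>A d t. A \<inter> {d (to_nat t)..}"
  have "\<exists>x. x \<in> followers (?\<psi> A d)" if "A \<in> \<A>" for A d
  proof -
    have "infinite A" using conjunct1[OF \<A>] that by blast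
    then show ?thesis using exists_follower[of "?\<psi> A d", OF infinite_cut] by blast
  qed
  then obtain x where x: "\<And>A d. A \<in> \<A> \<Longrightarrow> x A d \<in> followers (?\<psi> A d)" by metis
  let ?X = "(\<lambda>(A, d). x A d) ` (\<A> \<times> D)"
  have "?X \<subseteq> incr_inf" using x followers_subset_incr_inf by fast
  moreover have "?X \<notin> laver_ideal U"
  proof
    assume "?X \<in> laver_ideal U"
    then obtain \<phi> where \<phi>: "\<forall>t. \<phi> t \<in> U" "?X \<inter> followers \<phi> = {}"
      by (rule laver_idealE)
    have "countable (range \<phi>) \<and> range \<phi> \<subseteq> U" using \<phi>(1) by auto
    with \<A>[THEN conjunct2, rule_format]
    have "\<exists>A\<in>\<A>. \<forall>B\<in>range \<phi>. A \<subseteq>* B" .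
    then obtain A where A: "A \<in> \<A>" "\<And>t. A \<subseteq>* \<phi> t" by auto
    obtain d where d: "d \<in> D" "finite {t. \<not> ?\<psi> A d t \<subseteq> \<phi> t}"
      using dominating_threshold[OF D, of "\<lambda>t m. A \<inter> {m..} \<subseteq> \<phi> t"]
        almost_subset_cut_eventually[OF A(2)] by blast
    then have "x A d \<in> followers \<phi>"
      using followers_mono[of "?\<psi> A d" \<phi>] x[OF A(1), of d] by blast
    then show False using \<phi>(2) A(1) d(1) by blast
  qed
  ultimately show "\<exists>X. (X \<subseteq> incr_inf \<and> X \<notin> laver_ideal U) \<and> |X| \<le>o |\<A> \<times> D|"
    by (intro exI[of _ "?X"] conjI card_of_image) blast+
next
  fix \<A> :: "nat set set" assume "pi_chi_sigma_witness \<A>"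
  then show "\<A> \<noteq> {}" by (metis countable_empty empty_iff empty_subsetI)
qed (rule infinite_of_dominating)

text \<open>Assignments for the members of a cofinal family have countable ranges, which form the
  required families. Conversely, a countable family with a function selecting terms of its refining
  sequence yields one generator of the ideal.\<close>

theorem cof_laver_ideal:
  "cof_ideal (laver_ideal U) =o card_max (chi_sigma U) dominating_number"
  unfolding cof_ideal_def chi_sigma_def dominating_number_def
proof (rule least_card_eq_card_max[where Q = chi_sigma_witness and R = dominating,
      OF chi_sigma_witness_countable_sets exists_dominating])
  fix C assume C: "C \<subseteq> laver_ideal U \<and> (\<forall>X\<in>laver_ideal U. \<exists>Y\<in>C. X \<subseteq> Y)"
  then obtain \<Psi> where \<Psi>: "\<And>Y t. Y \<in> C \<Longrightarrow> \<Psi> Y t \<in> U" "\<And>Y. Y \<in> C \<Longrightarrow> Y \<subseteq> incr_inf"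
    "\<And>Y. Y \<in> C \<Longrightarrow> Y \<inter> followers (\<Psi> Y) = {}"
    using laver_ideal_choose by metis
  let ?\<AA> = "(\<lambda>Y. range (\<Psi> Y)) ` C"
  have guess: "\<exists>\<A>\<in>?\<AA>. \<forall>B\<in>\<B>. \<exists>A\<in>\<A>. A \<subseteq>* B"
    if \<B>: "countable \<B> \<and> \<B> \<subseteq> U" for \<B>
  proof -
    obtain \<phi> where \<phi>: "\<And>t. \<phi> t \<in> U"
      "\<And>x B. x \<in> followers \<phi> \<Longrightarrow> B \<in> \<B> \<Longrightarrow> \<forall>\<^sub>F n in sequentially. x n \<in> B"
      using countable_diagonal \<B> by metis
    obtain Y where Y: "Y \<in> C" "incr_inf - followers \<phi> \<subseteq> Y"
      using C compl_followers_mem[of \<phi>] \<phi>(1) by blast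
    \<comment> \<open>Otherwise some follower of \<open>\<Psi> Y\<close> avoids \<open>B\<close>. It
      is not in \<open>Y\<close>, so it follows \<phi> and must eventually enter
      \<open>B\<close>.\<close>
    have "\<exists>t. \<Psi> Y t \<subseteq>* B" if "B \<in> \<B>" for B
    proof (rule ccontr)
      assume "\<not> ?thesis"
      then obtain x where x: "x \<in> followers (\<Psi> Y)" "\<And>n. x n \<notin> B"
        using exists_follower_avoiding by blast
      then have "x \<in> followers \<phi>"
        using Y \<Psi>(3) followers_subset_incr_inf by blast
      then show False using \<phi>(2)[OF _ that] x(2) by fastforce
    qed
    then have "\<forall>B\<in>\<B>. \<exists>A\<in>range (\<Psi> Y). A \<subseteq>* B" by simp
    then show ?thesis using Y(1) by (rule bexI[OF _ imageI])
  qed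
  have "?\<AA> \<subseteq> {\<A>. countable \<A> \<and> \<A> \<subseteq> U}" using \<Psi>(1) by auto
  then have "chi_sigma_witness ?\<AA>" by (intro conjI allI impI) (assumption, rule guess)
  then show "\<exists>\<AA>. chi_sigma_witness \<AA> \<and> |\<AA>| \<le>o |C|"
    by (intro exI[of _ "?\<AA>"] conjI[OF _ card_of_image])
  \<comment> \<open>A point outside each member of a cofinal family gives a set outside the ideal,
    hence a dominating one.\<close>
  have "\<exists>x. x \<in> incr_inf \<and> x \<notin> Y" if "Y \<in> C" for Y
  proof -
    have "Y \<noteq> incr_inf" using conjunct1[OF C] that incr_inf_not_mem by auto
    then show ?thesis using \<Psi>(2)[OF that] by blast
  qed
  then obtain x where x: "\<And>Y. Y \<in> C \<Longrightarrow> x Y \<in> incr_inf \<and> x Y \<notin> Y" by metis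
  have "x ` C \<subseteq> incr_inf" using x by blast
  moreover have "x ` C \<notin> laver_ideal U"
  proof
    assume "x ` C \<in> laver_ideal U"
    then obtain Y where "Y \<in> C" "x ` C \<subseteq> Y" using conjunct2[OF C] by blast
    then show False using x by blast
  qed
  ultimately have "dominating (x ` C)" by (rule dominating_of_not_mem)
  then show "\<exists>D. dominating D \<and> |D| \<le>o |C|"
    by (intro exI[of _ "x ` C"] conjI[OF _ card_of_image])
next
  fix \<AA> :: "nat set set set" and D :: "(nat \<Rightarrow> nat) set"
  assume \<AA>: "chi_sigma_witness \<AA>" and D: "dominating D"
  have "\<exists>E. (\<forall>n. E n \<in> U) \<and>
    (\<forall>A. (\<exists>B\<in>\<A>. B \<subseteq>* A) \<longrightarrow> (\<forall>\<^sub>F m in sequentially. E m \<subseteq> A))" if "\<A> \<in> \<AA>" for \<A>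
    by (rule countable_refinement) (use conjunct1[OF \<AA>] that in auto)
  then obtain E where E: "\<And>\<A> n. \<A> \<in> \<AA> \<Longrightarrow> E \<A> n \<in> U"
    "\<And>\<A> A B. \<A> \<in> \<AA> \<Longrightarrow> B \<in> \<A> \<Longrightarrow> B \<subseteq>* A \<Longrightarrow> \<forall>\<^sub>F m in sequentially. E \<A> m \<subseteq> A"
    by metis
  \<comment> \<open>Here \<open>d\<close> picks the index in the refining sequence of \<A> to be
    used at \<open>t\<close>.\<close>
  let ?N = "\<lambda>(\<A>, d). incr_inf - followers (\<lambda>t. E \<A> (d (to_nat t)))"
  let ?C = "?N ` (\<AA> \<times> D)"
  have "?C \<subseteq> laver_ideal U"
    using E(1) by (auto intro!: compl_followers_mem)
  moreover have "\<exists>Y\<in>?C. X \<subseteq> Y" if X: "X \<in> laver_ideal U" for X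
  proof -
    obtain \<phi> where \<phi>: "\<forall>t. \<phi> t \<in> U" "X \<inter> followers \<phi> = {}"
      using X by (rule laver_idealE)
    have "countable (range \<phi>) \<and> range \<phi> \<subseteq> U" using \<phi>(1) by auto
    with \<AA>[THEN conjunct2, rule_format]
    have "\<exists>\<A>\<in>\<AA>. \<forall>B\<in>range \<phi>. \<exists>A\<in>\<A>. A \<subseteq>* B" .
    then obtain \<A> where \<A>: "\<A> \<in> \<AA>" "\<And>t. \<exists>A\<in>\<A>. A \<subseteq>* \<phi> t" by auto
    then obtain d where d: "d \<in> D" "finite {t. \<not> E \<A> (d (to_nat t)) \<subseteq> \<phi> t}"
      using dominating_threshold[OF D, of "\<lambda>t m. E \<A> m \<subseteq> \<phi> t"] E(2) by blast
    have "X \<subseteq> incr_inf" using X by (simp add: laver_ideal_iff)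
    then have "X \<subseteq> ?N (\<A>, d)" using followers_mono[OF d(2)] \<phi>(2) by auto
    then show ?thesis using \<A>(1) d(1) by blast
  qed
  ultimately show "\<exists>C. (C \<subseteq> laver_ideal U \<and> (\<forall>X\<in>laver_ideal U. \<exists>Y\<in>C. X \<subseteq> Y)) \<and>
      |C| \<le>o |\<AA> \<times> D|"
    by (intro exI[of _ "?C"] conjI card_of_image) blast+
next
  fix \<AA> :: "nat set set set" assume "chi_sigma_witness \<AA>"
  then show "\<AA> \<noteq> {}" by (metis countable_empty empty_iff empty_subsetI)
qed (rule infinite_of_dominating)

end

theorem theorem2:
  fixes U :: "nat set set"
  assumes "ultrafilter U" and "nonprincipal U"
  shows "add_ideal (laver_ideal U) =o card_min (p_prime U) bounding_number
    \<and> cov_ideal incr_inf (laver_ideal U) =o card_min (pi_p U) bounding_number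
    \<and> non_ideal incr_inf (laver_ideal U) =o card_max (pi_chi_sigma U) dominating_number
    \<and> cof_ideal (laver_ideal U) =o card_max (chi_sigma U) dominating_number"
proof -
  interpret nonprincipal_ultrafilter U
    using assms by unfold_locales
  show ?thesis
    using add_laver_ideal cov_laver_ideal non_laver_ideal cof_laver_ideal by blast
qed

end
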